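(* Let $X,Y$ be metric spaces with $X$ complete, $F:X\rightrightarrows Y$ a set-valued mapping, $\mu:[0,+\infty]\to[0,+\infty]$ an upper semicontinuous nondecreasing function, and $W\subset X\times Y$. Suppose that, for any $(x,y)\in W$, the inverse mapping $F^{-1}$ is closed at $y$ and, for some $\gamma>d(y,F(x))$ and any $t\in(0,\gamma)$, one of the following sets of conditions is satisfied: (i) there are sequences of positive numbers $(b_n)_{n\ge0}$ and $(c_n)_{n\ge1}$ and a function $m:(0,\infty)\to(0,\infty)$ such that $m(\tau)\downarrow0$ as $\tau\downarrow0$, $c_n\downarrow0$ as $n\to\infty$, $\sum_{n=0}^{\infty}b_n\le\mu(t)$, $$d\left(x,F^{-1}(B(y,m(c_1)))\right)<b_0,$$ $$d\left(u,F^{-1}(B(y,m(c_{n+1})))\right)<b_n\ \text{ for all } u\in F^{-1}(B(y,m(c_n)))\cap B\left(x,\sum_{i=0}^{n-1}b_i\right)\ (n=1,2,\ldots);$$ (ii) there are functions $b,m:(0,\infty)\to(0,\infty)$ such that $m(\tau)\downarrow0\Rightarrow\tau\downarrow0$ and, for any $\tau>0$ with $\mu(\tau)\le\mu(t)$, $\mu(\tau)\ge m(\tau)+\mu(b(\tau))$ and $$d\left(u,F^{-1}(B(y,b(\tau)))\right)<m(\tau)\ \text{ for all } u\in F^{-1}(B(y,\tau))\cap B(x,\mu(t)-\mu(\tau));$$ (iii) there are functions $b,m:(0,\infty)\to(0,\infty)$ such that $m(\tau)\downarrow0\Rightarrow\tau\downarrow0$ and, for any $\tau>0$ with $\mu(\tau)\le\mu(t)$,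 $\mu(\tau)\ge m(\tau)+\mu(b(\tau))$ and $$d\left(y,F(B(u,m(\tau)))\right)<b(\tau)\ \text{ for all } u\in F^{-1}(B(y,\tau))\cap B(x,\mu(t)-\mu(\tau)).$$ Then $F$ is metrically regular on $W$ with functional modulus $\mu$, i.e. $d(x,F^{-1}(y))\le\mu(d(y,F(x)))$ for all $(x,y)\in W$.
   Context: $B(x,r)$ is the open ball of radius $r>0$, $B(x,0)=\{x\}$, $B(x,+\infty)=X$; $(+\infty)-(+\infty):=0$. $d(x,C)=\inf_{c\in C}d(x,c)$, with $d(x,\emptyset)=+\infty$. Set-valued mappings have possibly empty values; $F^{-1}(y)=\{x\in X\mid y\in F(x)\}$, $F(A)=\bigcup_{z\in A}F(z)$, $F^{-1}(V)=\bigcup_{v\in V}F^{-1}(v)$. $F^{-1}$ is closed at $y$ if $y_n\to y$, $x_n\to z$ and $x_n\in F^{-1}(y_n)$ for all $n$ imply $z\in F^{-1}(y)$. The notation $\downarrow0$ means convergence to $0$ through positive values; "$m(\tau)\downarrow0\Rightarrow\tau\downarrow0$" means: for any sequence of positive numbers $(\tau_n)$, if $m(\tau_n)\to0$ then $\tau_n\to0$. The set of conditions that is satisfied, and the objects in it, may depend on $(x,y)$ and $t$. *)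

theory Defs
  imports "HOL-Analysis.Analysis"
begin

definition dist_set :: "'a::metric_space \<Rightarrow> 'a set \<Rightarrow> ennreal" where
  "dist_set x C = (INF c\<in>C. ennreal (dist x c))"

text \<open>Unlike \<^const>\<open>infdist\<close>, this distance takes the value \<open>\<infinity>\<close> on the empty set.\<close>

lemma dist_set_empty: "dist_set x {} = \<infinity>"
  by (simp add: dist_set_def)

definition xball :: "'a::metric_space \<Rightarrow> ennreal \<Rightarrow> 'a set" where
  "xball x r = (if r = 0 then {x} else {z. ennreal (dist x z) < r})"

lemma xball_ennreal: "0 < r \<Longrightarrow> xball x (ennreal r) = ball x r"
  by (auto simp: xball_def ennreal_less_iff)

lemma xball_top: "xball x \<infinity> = UNIV"
  by (simp add: xball_def)

text \<open>Subtraction on \<open>[0, \<infinity>]\<close> with \<open>\<infinity> - \<infinity> = 0\<close>; the subtraction of \<^typ>\<open>ennreal\<close> has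
  \<open>\<infinity> - \<infinity> = \<infinity>\<close>. It is only used for \<open>b \<le> a\<close>, so that truncation at 0 plays no role.\<close>

definition xminus :: "ennreal \<Rightarrow> ennreal \<Rightarrow> ennreal" where
  "xminus a b = (if a = \<infinity> \<and> b = \<infinity> then 0 else a - b)"

definition sv_image :: "('a \<Rightarrow> 'b set) \<Rightarrow> 'a set \<Rightarrow> 'b set" where
  "sv_image F A = (\<Union>z\<in>A. F z)"

definition sv_inv :: "('a \<Rightarrow> 'b set) \<Rightarrow> 'b \<Rightarrow> 'a set" where
  "sv_inv F y = {x. y \<in> F x}"

definition sv_closed_at :: "('b::metric_space \<Rightarrow> 'a::metric_space set) \<Rightarrow> 'b \<Rightarrow> bool" where
  "sv_closed_at G y \<longleftrightarrow>
     (\<forall>(v :: nat \<Rightarrow> 'b) (u :: nat \<Rightarrow> 'a) z.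
        v \<longlonglongrightarrow> y \<and> u \<longlonglongrightarrow> z \<and> (\<forall>n. u n \<in> G (v n)) \<longrightarrow> z \<in> G y)"

definition upper_semicontinuous ::
  "('a::topological_space \<Rightarrow> 'b::linorder_topology) \<Rightarrow> bool" where
  "upper_semicontinuous f \<longleftrightarrow> (\<forall>x c. f x < c \<longrightarrow> (\<forall>\<^sub>F z in nhds x. f z < c))"

definition metrically_regular_on ::
  "('a::metric_space \<Rightarrow> 'b::metric_space set) \<Rightarrow> ('a \<times> 'b) set \<Rightarrow> (ennreal \<Rightarrow> ennreal) \<Rightarrow> bool"
  where
  "metrically_regular_on F W \<mu> \<longleftrightarrow>
     (\<forall>(x, y)\<in>W. dist_set x (sv_inv F y) \<le> \<mu> (dist_set y (F x)))"

text \<open>The property written \<open>m(\<tau>)\<down>0 \<Rightarrow> \<tau>\<down>0\<close>.\<close>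

definition reflects_null :: "(real \<Rightarrow> real) \<Rightarrow> bool" where
  "reflects_null m \<longleftrightarrow>
     (\<forall>\<tau> :: nat \<Rightarrow> real. (\<forall>n. 0 < \<tau> n) \<and> (\<lambda>n. m (\<tau> n)) \<longlonglongrightarrow> 0 \<longrightarrow> \<tau> \<longlonglongrightarrow> 0)"

end

theory Submission
  imports Defs
begin

text \<open>
  Fix \<open>(x, y) \<in> W\<close> and a real \<open>t\<close> with \<open>d(y, F(x)) < t < \<gamma>\<close>.  Each of the three sets of
  conditions yields \<open>d(x, F\<^sup>-\<^sup>1(y)) \<le> \<mu>(t)\<close>; letting \<open>t\<close> decrease to \<open>d(y, F(x))\<close>, upper
  semicontinuity of \<open>\<mu>\<close> turns this into the claimed estimate.

  The core is a Lyusternik--Graves iteration (\<open>dist_set_inv_le_of_chain\<close>).  Starting from \<open>x\<close>, one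
  repeatedly moves by less than \<open>b\<^sub>n\<close> into \<open>F\<^sup>-\<^sup>1(B(y, r\<^sub>n\<^sub>+\<^sub>1))\<close>.  The total displacement is at most
  \<open>\<Sum>b\<^sub>n\<close>, so the points converge when this sum is finite, and since \<open>r\<^sub>n \<rightarrow> 0\<close> and \<open>F\<^sup>-\<^sup>1\<close> is closed
  at \<open>y\<close>, the limit lies in \<open>F\<^sup>-\<^sup>1(y)\<close>.

  Conditions (i) are the hypotheses of that iteration with \<open>r\<^sub>n = m(c\<^sub>n)\<close>.  Conditions (ii) reduce
  to them by iterating \<open>b\<close>: for \<open>\<tau>\<^sub>n = b\<^sup>n(t)\<close> the inequality \<open>m(\<tau>) + \<mu>(b(\<tau>)) \<le> \<mu>(\<tau>)\<close> telescopes to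
  \<open>\<Sum>\<^sub>i\<^sub><\<^sub>n m(\<tau>\<^sub>i) \<le> \<mu>(t) - \<mu>(\<tau>\<^sub>n)\<close>, which bounds the displacement by \<open>\<mu>(t)\<close>, keeps the iterates in the
  balls where (ii) applies, and forces \<open>m(\<tau>\<^sub>n) \<rightarrow> 0\<close>, hence \<open>\<tau>\<^sub>n \<rightarrow> 0\<close>.  Conditions (iii) imply (ii)
  with the same \<open>b\<close> and \<open>m\<close>, because a point of \<open>F(B(u, m(\<tau>)))\<close> near \<open>y\<close> is a value of \<open>F\<close> at a point
  of \<open>F\<^sup>-\<^sup>1(B(y, b(\<tau>)))\<close> near \<open>u\<close>.
\<close>

section \<open>Distances to sets and enlarged preimages\<close>

lemma dist_set_less_iff:
  "dist_set x C < ennreal e \<longleftrightarrow> (\<exists>c\<in>C. dist x c < e)"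
  by (simp add: dist_set_def INF_less_iff ennreal_less_iff)

lemma dist_set_le: "c \<in> C \<Longrightarrow> dist_set x C \<le> ennreal (dist x c)"
  unfolding dist_set_def by (rule INF_lower)

lemma in_inv_ball_iff:
  "u \<in> sv_image (sv_inv F) (ball y r) \<longleftrightarrow> (\<exists>v\<in>F u. dist y v < r)"
  by (auto simp: sv_image_def sv_inv_def)

lemma in_inv_ball_iff_dist_set:
  "u \<in> sv_image (sv_inv F) (ball y r) \<longleftrightarrow> dist_set y (F u) < ennreal r"
  by (simp add: in_inv_ball_iff dist_set_less_iff)

section \<open>The Lyusternik--Graves iteration\<close>

lemma dist_le_sum_steps:
  fixes u :: "nat \<Rightarrow> 'a::metric_space" and b :: "nat \<Rightarrow> real"
  assumes "\<And>n. dist (u n) (u (Suc n)) < b n" and "k \<le> n"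
  shows "dist (u k) (u n) \<le> (\<Sum>i<n. b i) - (\<Sum>i<k. b i)"
  using assms(2)
proof (induction n rule: dec_induct)
  case (step n)
  have "dist (u k) (u (Suc n)) \<le> dist (u k) (u n) + dist (u n) (u (Suc n))"
    by (rule dist_triangle)
  with step.IH assms(1)[of n] show ?case by simp
qed simp

lemma Cauchy_of_summable_steps:
  fixes u :: "nat \<Rightarrow> 'a::metric_space" and b :: "nat \<Rightarrow> real"
  assumes steps: "\<And>n. dist (u n) (u (Suc n)) < b n" and "summable b"
  shows "Cauchy u"
proof (rule metric_CauchyI)
  let ?S = "\<lambda>n. \<Sum>i<n. b i"
  fix e :: real assume "0 < e"
  have "Cauchy ?S"
    using \<open>summable b\<close> by (simp add: summable_iff_convergent convergent_Cauchy)
  then obtain N where N: "\<And>k n. k \<ge> N \<Longrightarrow> n \<ge> N \<Longrightarrow> dist (?S k) (?S n) < e"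
    using \<open>0 < e\<close> by (meson metric_CauchyD)
  have "dist (u k) (u n) \<le> dist (?S k) (?S n)" for k n
  proof (cases k n rule: le_cases)
    case le
    from dist_le_sum_steps[of u b, OF steps le] show ?thesis by (simp add: dist_real_def)
  next
    case ge
    from dist_le_sum_steps[of u b, OF steps ge] show ?thesis
      by (simp add: dist_real_def dist_commute)
  qed
  then show "\<exists>N. \<forall>k\<ge>N. \<forall>n\<ge>N. dist (u k) (u n) < e"
    using N by (meson le_less_trans)
qed

text \<open>
  The iteration itself.  Every iterate after the first stays in the ball \<open>B(x, \<Sum>\<^sub>i\<^sub><\<^sub>n b\<^sub>i)\<close> by the
  triangle inequality, so the step condition can be applied again.  The inequality there is strict,
  which excludes \<open>n = 0\<close> (the ball is empty); this is why the first step is a separate hypothesis.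
  For \<open>M = \<infinity>\<close> the claim is trivial, and otherwise \<open>\<Sum>b\<^sub>n\<close> is finite.
\<close>

lemma dist_set_inv_le_of_chain:
  fixes F :: "'a::complete_space \<Rightarrow> 'b::metric_space set"
    and b r :: "nat \<Rightarrow> real"
  assumes closed: "sv_closed_at (sv_inv F) y"
    and b_pos: "\<And>n. 0 < b n"
    and r_null: "r \<longlonglongrightarrow> 0"
    and sum_le: "(\<Sum>n. ennreal (b n)) \<le> M"
    and first: "dist_set x (sv_image (sv_inv F) (ball y (r 1))) < ennreal (b 0)"
    and step: "\<And>n u. n \<ge> 1 \<Longrightarrow> u \<in> sv_image (sv_inv F) (ball y (r n)) \<Longrightarrow>
      u \<in> ball x (\<Sum>i<n. b i) \<Longrightarrow>
      dist_set u (sv_image (sv_inv F) (ball y (r (n + 1)))) < ennreal (b n)"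
  shows "dist_set x (sv_inv F y) \<le> M"
proof (cases "M = \<infinity>")
  case False
  let ?A = "\<lambda>n. sv_image (sv_inv F) (ball y (r n))"
  let ?P = "\<lambda>n u. if n = 0 then u = x else u \<in> ?A n \<and> dist x u < (\<Sum>i<n. b i)"
  have "\<exists>u. \<forall>n. ?P n (u n) \<and> dist (u n) (u (Suc n)) < b n"
  proof (rule dependent_nat_choice[of ?P "\<lambda>n u u'. dist u u' < b n"])
    show "\<exists>u. ?P 0 u" by simp
    fix u n assume P: "?P n u"
    have "dist_set u (?A (Suc n)) < ennreal (b n)"
      using P first step[of n u] by (cases "n = 0") auto
    then obtain u' where u': "u' \<in> ?A (Suc n)" "dist u u' < b n"
      unfolding dist_set_less_iff by blast
    have "dist x u \<le> (\<Sum>i<n. b i)"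
      using P by (cases "n = 0") auto
    then have "dist x u' < (\<Sum>i<Suc n. b i)"
      using u'(2) dist_triangle[of x u' u] by simp
    with u' show "\<exists>u'. ?P (Suc n) u' \<and> dist u u' < b n" by auto
  qed
  then obtain u where u: "\<And>n. ?P n (u n)" and steps: "\<And>n. dist (u n) (u (Suc n)) < b n"
    by blast
  have u0: "u 0 = x" using u[of 0] by simp
  have fin: "(\<Sum>n. ennreal (b n)) \<noteq> top"
    using sum_le False by (auto simp: top_unique)
  have b_nonneg: "0 \<le> b n" for n using b_pos[of n] by simp
  have summ: "summable b"
    by (rule summable_suminf_not_top[OF b_nonneg fin])
  obtain z where z: "u \<longlonglongrightarrow> z"
    using Cauchy_of_summable_steps[of u b, OF steps summ]
    by (auto simp: Cauchy_convergent_iff convergent_def)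
  have "dist x (u n) \<le> suminf b" for n
    using dist_le_sum_steps[of u b 0 n, OF steps] sum_le_suminf[OF summ, of "{..<n}"]
    by (simp add: u0 b_nonneg)
  moreover have "(\<lambda>n. dist x (u n)) \<longlonglongrightarrow> dist x z"
    by (intro tendsto_intros z)
  ultimately have "dist x z \<le> suminf b"
    by (intro LIMSEQ_le_const2) auto
  also have "ennreal (suminf b) = (\<Sum>n. ennreal (b n))"
    by (rule suminf_ennreal2[OF b_nonneg summ, symmetric])
  finally have xz: "ennreal (dist x z) \<le> M"
    using sum_le by (simp add: ennreal_leI)
  have "\<forall>n. \<exists>v. v \<in> F (u (Suc n)) \<and> dist y v < r (Suc n)"
    using u[of "Suc n" for n] by (simp add: in_inv_ball_iff) blast
  then obtain v where v: "\<And>n. v n \<in> F (u (Suc n))" "\<And>n. dist y (v n) < r (Suc n)"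
    by metis
  have "(\<lambda>n. dist (v n) y) \<longlonglongrightarrow> 0"
    by (rule tendsto_sandwich[OF _ _ tendsto_const LIMSEQ_Suc[OF r_null]])
      (auto simp: dist_commute intro!: always_eventually less_imp_le v(2))
  then have "v \<longlonglongrightarrow> y" using tendsto_dist_iff by blast
  moreover have "(\<lambda>n. u (Suc n)) \<longlonglongrightarrow> z" by (rule LIMSEQ_Suc[OF z])
  moreover have "\<forall>n. u (Suc n) \<in> sv_inv F (v n)" using v(1) by (simp add: sv_inv_def)
  ultimately have "z \<in> sv_inv F y"
    using closed unfolding sv_closed_at_def by blast
  from dist_set_le[OF this, of x] xz show ?thesis by (rule order_trans)
qed simp

section \<open>Iteration driven by a decreasing modulus\<close>

text \<open>
  Conditions (ii) along the orbit \<open>\<tau>\<^sub>n = b\<^sup>n(t)\<close>.  The ball of condition (ii) is \<open>{x}\<close> at \<open>n = 0\<close>;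
  for \<open>n \<ge> 1\<close> its radius is positive and at least \<open>\<Sum>\<^sub>i\<^sub><\<^sub>n m(\<tau>\<^sub>i)\<close>.
\<close>

lemma dist_set_inv_le_of_decrease:
  fixes F :: "'a::complete_space \<Rightarrow> 'b::metric_space set"
    and b m :: "real \<Rightarrow> real" and \<mu> :: "ennreal \<Rightarrow> ennreal"
  assumes closed: "sv_closed_at (sv_inv F) y"
    and t: "0 < t" "x \<in> sv_image (sv_inv F) (ball y t)"
    and b_pos: "\<And>\<tau>. 0 < \<tau> \<Longrightarrow> 0 < b \<tau>"
    and m_pos: "\<And>\<tau>. 0 < \<tau> \<Longrightarrow> 0 < m \<tau>"
    and m_null: "reflects_null m"
    and decrease: "\<And>\<tau>. 0 < \<tau> \<Longrightarrow> \<mu> (ennreal \<tau>) \<le> \<mu> (ennreal t) \<Longrightarrow>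
      ennreal (m \<tau>) + \<mu> (ennreal (b \<tau>)) \<le> \<mu> (ennreal \<tau>)"
    and step: "\<And>\<tau> u. 0 < \<tau> \<Longrightarrow> \<mu> (ennreal \<tau>) \<le> \<mu> (ennreal t) \<Longrightarrow>
      u \<in> sv_image (sv_inv F) (ball y \<tau>) \<Longrightarrow>
      u \<in> xball x (xminus (\<mu> (ennreal t)) (\<mu> (ennreal \<tau>))) \<Longrightarrow>
      dist_set u (sv_image (sv_inv F) (ball y (b \<tau>))) < ennreal (m \<tau>)"
  shows "dist_set x (sv_inv F y) \<le> \<mu> (ennreal t)"
proof (cases "\<mu> (ennreal t) = \<infinity>")
  case False
  define \<tau> where "\<tau> n = (b ^^ n) t" for n
  have \<tau>0: "\<tau> 0 = t" and \<tau>_Suc: "\<tau> (Suc n) = b (\<tau> n)" for n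
    by (simp_all add: \<tau>_def)
  have \<tau>_pos: "0 < \<tau> n" for n
    by (induction n) (simp_all add: \<tau>0 \<tau>_Suc t b_pos)
  have m_nonneg: "0 \<le> m (\<tau> n)" for n
    using m_pos[OF \<tau>_pos[of n]] by simp
  have telescope: "ennreal (\<Sum>i<n. m (\<tau> i)) + \<mu> (ennreal (\<tau> n)) \<le> \<mu> (ennreal t)" for n
  proof (induction n)
    case (Suc n)
    \<comment> \<open>the orbit never leaves the set of \<open>\<tau>\<close> with \<open>\<mu>(\<tau>) \<le> \<mu>(t)\<close>, where the decrease inequality holds\<close>
    have "\<mu> (ennreal (\<tau> n)) \<le> \<mu> (ennreal t)"
      by (rule order_trans[OF add_increasing[OF zero_le order_refl] Suc])
    from decrease[OF \<tau>_pos this]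
    have "ennreal (\<Sum>i<n. m (\<tau> i)) + (ennreal (m (\<tau> n)) + \<mu> (ennreal (\<tau> (Suc n))))
        \<le> ennreal (\<Sum>i<n. m (\<tau> i)) + \<mu> (ennreal (\<tau> n))"
      unfolding \<tau>_Suc by (rule add_left_mono)
    also note Suc
    finally show ?case
      by (simp add: m_nonneg sum_nonneg add.assoc)
  qed (simp add: \<tau>0)
  have \<mu>_le: "\<mu> (ennreal (\<tau> n)) \<le> \<mu> (ennreal t)" for n
    by (rule order_trans[OF add_increasing[OF zero_le order_refl] telescope])
  have sum_le: "(\<Sum>n. ennreal (m (\<tau> n))) \<le> \<mu> (ennreal t)"
  proof (rule suminf_le_const)
    fix n
    have "ennreal (\<Sum>i<n. m (\<tau> i)) \<le> \<mu> (ennreal t)"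
      by (rule order_trans[OF add_increasing2[OF zero_le order_refl] telescope])
    then show "(\<Sum>i<n. ennreal (m (\<tau> i))) \<le> \<mu> (ennreal t)"
      by (simp add: m_nonneg)
  qed simp
  have "summable (\<lambda>n. m (\<tau> n))"
    by (rule summable_suminf_not_top[OF m_nonneg]) (use sum_le False in \<open>auto simp: top_unique\<close>)
  then have \<tau>_null: "\<tau> \<longlonglongrightarrow> 0"
    using m_null \<tau>_pos summable_LIMSEQ_zero unfolding reflects_null_def by blast
  show ?thesis
  proof (rule dist_set_inv_le_of_chain[OF closed m_pos[OF \<tau>_pos] \<tau>_null sum_le])
    have "x \<in> xball x (xminus (\<mu> (ennreal t)) (\<mu> (ennreal t)))"
      by (auto simp: xball_def zero_less_iff_neq_zero)
    from step[OF t(1) order_refl t(2) this]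
    show "dist_set x (sv_image (sv_inv F) (ball y (\<tau> 1))) < ennreal (m (\<tau> 0))"
      by (simp add: \<tau>0 \<tau>_def)
  next
    fix n u assume "n \<ge> 1" and u: "u \<in> sv_image (sv_inv F) (ball y (\<tau> n))"
      and near: "u \<in> ball x (\<Sum>i<n. m (\<tau> i))"
    define R where "R = \<mu> (ennreal t) - \<mu> (ennreal (\<tau> n))"
    \<comment> \<open>finiteness lets \<open>\<mu>(\<tau>\<^sub>n)\<close> be moved to the other side of the telescoped inequality\<close>
    have "\<mu> (ennreal (\<tau> n)) \<noteq> top"
      using \<mu>_le[of n] False by (auto simp: top_unique)
    then have "ennreal (\<Sum>i<n. m (\<tau> i))
        = ennreal (\<Sum>i<n. m (\<tau> i)) + \<mu> (ennreal (\<tau> n)) - \<mu> (ennreal (\<tau> n))"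
      by (rule ennreal_add_diff_cancel_right[symmetric])
    also have "\<dots> \<le> R"
      unfolding R_def by (rule ennreal_minus_mono[OF telescope order_refl])
    finally have "ennreal (\<Sum>i<n. m (\<tau> i)) \<le> R" .
    moreover have "ennreal (dist x u) < ennreal (\<Sum>i<n. m (\<tau> i))"
      using near by (simp add: ennreal_less_iff)
    ultimately have "ennreal (dist x u) < R" by (rule order.strict_trans2[rotated])
    then have "u \<in> xball x (xminus (\<mu> (ennreal t)) (\<mu> (ennreal (\<tau> n))))"
      using False by (auto simp: xball_def xminus_def R_def)
    from step[OF \<tau>_pos \<mu>_le u this]
    show "dist_set u (sv_image (sv_inv F) (ball y (\<tau> (n + 1)))) < ennreal (m (\<tau> n))"
      by (simp add: \<tau>_Suc)
  qed
qed simp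

lemma dist_set_inv_ball_less_of_image_ball:
  assumes "dist_set y (sv_image F (ball u s)) < ennreal r"
  shows "dist_set u (sv_image (sv_inv F) (ball y r)) < ennreal s"
proof -
  obtain z v where "dist u z < s" "v \<in> F z" "dist y v < r"
    using assms unfolding dist_set_less_iff sv_image_def by auto
  then show ?thesis
    unfolding dist_set_less_iff by (intro bexI[of _ z]) (auto simp: in_inv_ball_iff)
qed

section \<open>Metric regularity\<close>

text \<open>
  A function that is upper semicontinuous at \<open>a\<close> and falls below \<open>D\<close> there stays below \<open>D\<close> just to
  the right of \<open>a\<close>, and every point strictly between \<open>a\<close> and another extended number is finite.
\<close>

lemma le_at_of_le_right:
  fixes \<mu> :: "ennreal \<Rightarrow> ennreal"
  assumes usc: "upper_semicontinuous \<mu>" and "a < \<gamma>"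
    and le: "\<And>t::real. a < ennreal t \<Longrightarrow> ennreal t < \<gamma> \<Longrightarrow> D \<le> \<mu> (ennreal t)"
  shows "D \<le> \<mu> a"
proof (rule ccontr)
  assume "\<not> D \<le> \<mu> a"
  then have "\<forall>\<^sub>F s in nhds a. \<mu> s < D"
    using usc unfolding upper_semicontinuous_def by (simp add: not_le)
  then have "\<forall>\<^sub>F s in at_right a. \<mu> s < D"
    by (simp add: eventually_nhds_conv_at eventually_at_split filter_leD[OF at_le])
  then obtain s0 where s0: "a < s0" "\<And>s. a < s \<Longrightarrow> s < s0 \<Longrightarrow> \<mu> s < D"
    unfolding eventually_at_right[OF \<open>a < \<gamma>\<close>] by auto
  obtain s where s: "a < s" "s < min s0 \<gamma>"
    using dense[of a "min s0 \<gamma>"] s0(1) \<open>a < \<gamma>\<close> by auto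
  then obtain t :: real where "s = ennreal t"
    by (cases s) (auto simp: less_top[symmetric])
  with s le[of t] s0(2)[of s] show False by auto
qed

theorem theorem4p7:
  fixes F :: "'a::complete_space \<Rightarrow> 'b::metric_space set"
    and \<mu> :: "ennreal \<Rightarrow> ennreal"
    and W :: "('a \<times> 'b) set"
  assumes "upper_semicontinuous \<mu>" and "mono \<mu>"
    and closed: "\<And>x y. (x, y) \<in> W \<Longrightarrow> sv_closed_at (sv_inv F) y"
    and conditions: "\<And>x y. (x, y) \<in> W \<Longrightarrow>
      \<exists>\<gamma>::ennreal. \<gamma> > dist_set y (F x) \<and>
        (\<forall>t::real. 0 < t \<and> ennreal t < \<gamma> \<longrightarrow>
          (\<exists>(b :: nat \<Rightarrow> real) (c :: nat \<Rightarrow> real) (m :: real \<Rightarrow> real).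
              (\<forall>n. 0 < b n) \<and> (\<forall>n\<ge>1. 0 < c n) \<and> (\<forall>\<tau>>0. 0 < m \<tau>) \<and>
              (m \<longlongrightarrow> 0) (at_right 0) \<and> c \<longlonglongrightarrow> 0 \<and>
              (\<Sum>n. ennreal (b n)) \<le> \<mu> (ennreal t) \<and>
              dist_set x (sv_image (sv_inv F) (ball y (m (c 1)))) < ennreal (b 0) \<and>
              (\<forall>n\<ge>1. \<forall>u \<in> sv_image (sv_inv F) (ball y (m (c n))) \<inter> ball x (\<Sum>i<n. b i).
                 dist_set u (sv_image (sv_inv F) (ball y (m (c (n + 1))))) < ennreal (b n)))
          \<or>
          (\<exists>(b :: real \<Rightarrow> real) (m :: real \<Rightarrow> real).
              (\<forall>\<tau>>0. 0 < b \<tau>) \<and> (\<forall>\<tau>>0. 0 < m \<tau>) \<and> reflects_null m \<and>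
              (\<forall>\<tau>>0. \<mu> (ennreal \<tau>) \<le> \<mu> (ennreal t) \<longrightarrow>
                 \<mu> (ennreal \<tau>) \<ge> ennreal (m \<tau>) + \<mu> (ennreal (b \<tau>)) \<and>
                 (\<forall>u \<in> sv_image (sv_inv F) (ball y \<tau>) \<inter>
                        xball x (xminus (\<mu> (ennreal t)) (\<mu> (ennreal \<tau>))).
                    dist_set u (sv_image (sv_inv F) (ball y (b \<tau>))) < ennreal (m \<tau>))))
          \<or>
          (\<exists>(b :: real \<Rightarrow> real) (m :: real \<Rightarrow> real).
              (\<forall>\<tau>>0. 0 < b \<tau>) \<and> (\<forall>\<tau>>0. 0 < m \<tau>) \<and> reflects_null m \<and>
              (\<forall>\<tau>>0. \<mu> (ennreal \<tau>) \<le> \<mu> (ennreal t) \<longrightarrow>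
                 \<mu> (ennreal \<tau>) \<ge> ennreal (m \<tau>) + \<mu> (ennreal (b \<tau>)) \<and>
                 (\<forall>u \<in> sv_image (sv_inv F) (ball y \<tau>) \<inter>
                        xball x (xminus (\<mu> (ennreal t)) (\<mu> (ennreal \<tau>))).
                    dist_set y (sv_image F (ball u (m \<tau>))) < ennreal (b \<tau>)))))"
  shows "metrically_regular_on F W \<mu>"
proof -
  have "dist_set x (sv_inv F y) \<le> \<mu> (dist_set y (F x))" if W: "(x, y) \<in> W" for x y
  proof -
    from conditions[OF W] show ?thesis
    proof (elim exE conjE, goal_cases)
      case \<gamma>: (1 \<gamma>)
      show ?case
      proof (rule le_at_of_le_right[OF \<open>upper_semicontinuous \<mu>\<close> \<gamma>(1)])
        fix t :: real assume t: "dist_set y (F x) < ennreal t" "ennreal t < \<gamma>"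
        have t_pos: "0 < t" using t(1) by (metis ennreal_eq_0_iff not_less not_less_zero)
        have x_in: "x \<in> sv_image (sv_inv F) (ball y t)"
          using t(1) by (simp add: in_inv_ball_iff_dist_set)
        from \<gamma>(2)[THEN spec, THEN mp, OF conjI[OF t_pos t(2)]]
        show "dist_set x (sv_inv F y) \<le> \<mu> (ennreal t)"
        proof (elim disjE exE conjE, goal_cases)
          case i: (1 b c m)
          have "\<forall>\<^sub>F n in sequentially. c n > 0 \<and> c n \<noteq> 0"
            by (rule eventually_sequentiallyI[of 1]) (use i(2) in force)
          with i(5) have "filterlim c (at_right 0) sequentially"
            by (simp add: filterlim_at)
          with i(4) have m_c_null: "(\<lambda>n. m (c n)) \<longlonglongrightarrow> 0"
            by (rule filterlim_compose)
          show ?case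
            by (rule dist_set_inv_le_of_chain[OF closed[OF W] _ m_c_null i(6,7)])
              (use i(1,8) in blast)+
        next
          case ii: (2 b m)
          show ?case
            by (rule dist_set_inv_le_of_decrease[OF closed[OF W] t_pos x_in, of b m])
              (use ii in blast)+
        next
          case iii: (3 b m)
          show ?case
            by (rule dist_set_inv_le_of_decrease[OF closed[OF W] t_pos x_in, of b m])
              (use iii dist_set_inv_ball_less_of_image_ball in blast)+
        qed
      qed
    qed
  qed
  then show ?thesis by (auto simp: metrically_regular_on_def)
qed

end
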